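(* Consider the feasibility program $f_j(x)\le 0$ for all $j\in[m]$, $x\in\mathcal{P}$, where $\mathcal{P}\subset\mathbb{R}^n$ is a convex compact set and each $f_j:\mathcal{P}\to\mathbb{R}$ is convex, and let $g(x,p)=\sum_j p_jf_j(x)$ for $x\in\mathcal{P}$, $p\in\mathbb{S}_m$. Suppose OnlineAlg is an online convex optimization algorithm with low regret. If a solution to the program exists, then the meta-algorithms PrimalGameOpt, DualGameOpt and PrimalDualGameOpt (run with parameter $\varepsilon>0$) return an $\varepsilon$-approximate solution. Otherwise, PrimalGameOpt and DualGameOpt return a dual solution proving that the program is infeasible, i.e. a $p\in\mathbb{S}_m$ with $g(x,p)>0$ for all $x\in\mathcal{P}$, and PrimalDualGameOpt returns a dual solution proving the program to be $\varepsilon$-close to being infeasible, i.e. a $p\in\mathbb{S}_m$ with $g(x,p)>-\varepsilon$ for all $x\in\mathcal{P}$ (so that the program $f_j(x)\le-\varepsilon\ \forall j$, $x\in\mathcal{P}$, is infeasible). Further, an $\varepsilon$-approximate solution is returned in $O(R/\varepsilon)$ iterations, where $R=R(\mathrm{OnlineAlg},\varepsilon)$ is the smallest number $T$ satisfying $\mathrm{Regret}(\mathrm{OnlineAlg},T)\le\varepsilon T$.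
   Context: $\mathbb{S}_m=\{p\in\mathbb{R}^m:\sum_ip_i=1,\ p_i\ge0\}$. An $\varepsilon$-approximate solution is a point $x\in\mathcal{P}$ with $f_j(x)\le\varepsilon$ for all $j$. Online convex optimization over a convex compact set $K$: at each round $t$ the algorithm picks $z_t\in K$ knowing only $K$, $z_1,\dots,z_{t-1}$ and previous convex cost functions $c_1,\dots,c_{t-1}$, then incurs $c_t(z_t)$. Its regret is $\mathrm{Regret}(\mathcal{A},T)=\sup_{c_1,\dots,c_T}\{\sum_{t=1}^Tc_t(z_t)-\min_{z^*\in K}\sum_{t=1}^Tc_t(z^* )\}$ (for maximization with concave payoffs, the analogous quantity $\max_{z^*}\sum_t c_t(z^* )-\sum_tc_t(z_t)$). "Low regret" means $\mathrm{Regret}(\mathcal{A},T)=o(T)$; OnlineAlg denotes such an algorithm. Separation Oracle: on input $x\in\mathcal{P}$ returns $j$ with $f_j(x)>\varepsilon$ if one exists, else FAIL. Optimization Oracle: on input $p\in\mathbb{S}_m$ returns $x\in\mathcal{P}$ with $\sum_jp_jf_j(x)\le0$ if one exists, else FAIL. PrimalGameOpt($\varepsilon$): starting with $t=1$, while $\mathrm{Regret}(\mathrm{OnlineAlg},t)\ge\varepsilon t$: let $x_t\in\mathcal{P}$ be the output of OnlineAlg on the cost functions $x\mapsto g(x,p_s)$, $s<t$; call the Separation Oracle on $x_t$; if FAIL return $x_t$; else if it returns $j$, set $p_t=e_j$ (the $j$-th standard basis vector of $\mathbb{R}^m$); increment $t$. On exiting the loop at $t=T$, return $\bar p=\frac1T\sum_{t}p_t$.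 DualGameOpt($\varepsilon$): while $\mathrm{Regret}(\mathrm{OnlineAlg},t)\ge\varepsilon t$: let $p_t\in\mathbb{S}_m$ be the output of OnlineAlg (maximizing) on payoff functions $p\mapsto g(x_s,p)$, $s<t$; let $x_t$ be the Optimization Oracle's answer on $p_t$; if FAIL return $p_t$; increment $t$. On exit return $\bar x=\frac1T\sum_tx_t$. PrimalDualGameOpt($\varepsilon$): while $\mathrm{Regret}(\mathrm{OnlineAlg},t)\ge\frac{\varepsilon}{2}t$: let $x_t$ be the output of OnlineAlg on costs $x\mapsto g(x,p_s)$, $s<t$, and $p_t$ the output of OnlineAlg on payoffs $p\mapsto g(x_s,p)$, $s<t$; increment $t$. Then if $\bar x=\frac1T\sum_tx_t$ is $\varepsilon$-approximate return $\bar x$, else return $\bar p=\frac1T\sum_tp_t$.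
   Formalization: If infeasible, an ε-approximate solution may be returned instead, unless none exists; R is taken at the loop's own threshold (ε/2 for PrimalDualGameOpt), or just below it in case of equality; averages are over exactly T played rounds; regret is over an admissible class of functions. *)

theory Defs
  imports "HOL-Analysis.Analysis" "HOL-Library.While_Combinator"
begin

definition prob_simplex :: "(real ^ 'm) set" where
  "prob_simplex = {p. (\<Sum>j\<in>UNIV. p $ j) = 1 \<and> (\<forall>j. 0 \<le> p $ j)}"

definition game :: "('m::finite \<Rightarrow> 'x \<Rightarrow> real) \<Rightarrow> 'x \<Rightarrow> real ^ 'm \<Rightarrow> real" where
  "game f x p = (\<Sum>j\<in>UNIV. p $ j * f j x)"

definition approx_solution :: "('m \<Rightarrow> 'x \<Rightarrow> real) \<Rightarrow> 'x set \<Rightarrow> real \<Rightarrow> 'x \<Rightarrow> bool" where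
  "approx_solution f P \<epsilon> x \<longleftrightarrow> x \<in> P \<and> (\<forall>j. f j x \<le> \<epsilon>)"

definition feasible :: "('m \<Rightarrow> 'x \<Rightarrow> real) \<Rightarrow> 'x set \<Rightarrow> bool" where
  "feasible f P \<longleftrightarrow> (\<exists>x\<in>P. \<forall>j. f j x \<le> 0)"


section \<open>Online convex optimization\<close>

text \<open>
  A (deterministic) online algorithm for a fixed decision set maps the history
  $(z_1,c_1),\dots,(z_{t-1},c_{t-1})$, in chronological order, to the next decision $z_t$.
\<close>

type_synonym 'a online_alg = "('a \<times> ('a \<Rightarrow> real)) list \<Rightarrow> 'a"

definition online_algorithm :: "'a online_alg \<Rightarrow> 'a set \<Rightarrow> ('a \<Rightarrow> real) set \<Rightarrow> bool" where
  "online_algorithm A K C \<longleftrightarrow> (\<forall>h. set h \<subseteq> K \<times> C \<longrightarrow> A h \<in> K)"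

definition transcript :: "'a online_alg \<Rightarrow> ('a \<Rightarrow> real) list \<Rightarrow> ('a \<times> ('a \<Rightarrow> real)) list" where
  "transcript A cs = foldl (\<lambda>h c. h @ [(A h, c)]) [] cs"

definition incurred :: "'a online_alg \<Rightarrow> ('a \<Rightarrow> real) list \<Rightarrow> real" where
  "incurred A cs = (\<Sum>(z, c)\<leftarrow>transcript A cs. c z)"

text \<open>
  The supremum ranges over sequences from a class \<open>C\<close> of admissible functions: over \<^emph>\<open>all\<close> convex
  functions it is infinite, by scaling, unless the decision set is trivial. Values are extended
  reals, so that an unbounded supremum really is \<open>\<infinity>\<close>; and since a convex function on a compact set
  need not attain its minimum at the boundary, the minimum is an infimum.
\<close>

definition cost_regret ::
    "'a online_alg \<Rightarrow> 'a set \<Rightarrow> ('a \<Rightarrow> real) set \<Rightarrow> nat \<Rightarrow> ereal" where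
  "cost_regret A K C T =
     (SUP cs\<in>{cs. length cs = T \<and> set cs \<subseteq> C}.
        ereal (incurred A cs) - (INF z\<in>K. ereal (\<Sum>c\<leftarrow>cs. c z)))"

definition payoff_regret ::
    "'a online_alg \<Rightarrow> 'a set \<Rightarrow> ('a \<Rightarrow> real) set \<Rightarrow> nat \<Rightarrow> ereal" where
  "payoff_regret A K C T =
     (SUP cs\<in>{cs. length cs = T \<and> set cs \<subseteq> C}.
        (SUP z\<in>K. ereal (\<Sum>c\<leftarrow>cs. c z)) - ereal (incurred A cs))"

definition low_regret :: "(nat \<Rightarrow> ereal) \<Rightarrow> bool" where
  "low_regret \<rho> \<longleftrightarrow> (\<lambda>T. \<rho> T / ereal (real T)) \<longlonglongrightarrow> 0"

text \<open>\<open>T = 0\<close> is excluded, as it satisfies the inequality trivially.\<close>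

definition regret_time :: "(nat \<Rightarrow> ereal) \<Rightarrow> real \<Rightarrow> nat" where
  "regret_time \<rho> \<delta> = (LEAST T. 1 \<le> T \<and> \<rho> T \<le> ereal (\<delta> * real T))"

text \<open>
  A loop guarded by $\rho(t)\ge\theta t$ is left at the first \<open>T\<close> with the strict inequality
  $\rho(T)<\theta T$. This is \<open>regret_time \<rho> \<theta>\<close> itself unless $\rho(T)=\theta T$ there; in any case
  it is at most \<open>regret_time \<rho> \<delta>\<close> for each \<open>\<delta> < \<theta>\<close>.
\<close>

definition within_regret_time :: "(nat \<Rightarrow> ereal) \<Rightarrow> real \<Rightarrow> nat \<Rightarrow> bool" where
  "within_regret_time \<rho> \<theta> N \<longleftrightarrow>
     (\<rho> (regret_time \<rho> \<theta>) < ereal (\<theta> * real (regret_time \<rho> \<theta>)) \<longrightarrow> N \<le> regret_time \<rho> \<theta>) \<and>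
     (\<forall>\<delta>. 0 < \<delta> \<and> \<delta> < \<theta> \<longrightarrow> N \<le> regret_time \<rho> \<delta>)"


section \<open>Oracles\<close>

text \<open>\<open>None\<close> is the answer FAIL.\<close>

definition separation_oracle ::
    "('m \<Rightarrow> 'x \<Rightarrow> real) \<Rightarrow> 'x set \<Rightarrow> real \<Rightarrow> ('x \<Rightarrow> 'm option) \<Rightarrow> bool" where
  "separation_oracle f P \<epsilon> sep \<longleftrightarrow>
     (\<forall>x\<in>P. case sep x of Some j \<Rightarrow> f j x > \<epsilon> | None \<Rightarrow> \<not> (\<exists>j. f j x > \<epsilon>))"

definition optimization_oracle ::
    "('m::finite \<Rightarrow> 'x \<Rightarrow> real) \<Rightarrow> 'x set \<Rightarrow> (real ^ 'm \<Rightarrow> 'x option) \<Rightarrow> bool" where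
  "optimization_oracle f P opt \<longleftrightarrow>
     (\<forall>p\<in>prob_simplex. case opt p of
          Some x \<Rightarrow> x \<in> P \<and> game f x p \<le> 0
        | None \<Rightarrow> \<not> (\<exists>x\<in>P. game f x p \<le> 0))"


section \<open>The meta-algorithms\<close>

text \<open>
  Each meta-algorithm yields \<open>None\<close> if its loop does not terminate, and otherwise
  \<open>Some (output, N)\<close> where \<open>N\<close> is the number of executed loop iterations.

  The loop state holds the history of completed rounds $(x_s,p_s)$, and the guard
  $\mathrm{Regret}(t)\ge\varepsilon t$ is evaluated for the number \<open>t\<close> of completed rounds. It
  holds for \<open>t = 0\<close>, so a first round is always played, and on a regular exit at \<open>T\<close> exactly \<open>T\<close>
  rounds have been played, as the average of \<open>T\<close> points that is then returned requires.
\<close>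

datatype ('x, 'p) result = Primal 'x | Dual 'p

definition cost_history ::
    "('m::finite \<Rightarrow> 'x \<Rightarrow> real) \<Rightarrow> ('x \<times> (real ^ 'm)) list \<Rightarrow> ('x \<times> ('x \<Rightarrow> real)) list" where
  "cost_history f h = map (\<lambda>(x, p). (x, \<lambda>y. game f y p)) h"

definition payoff_history ::
    "('m::finite \<Rightarrow> 'x \<Rightarrow> real) \<Rightarrow> ('x \<times> (real ^ 'm)) list \<Rightarrow>
     ((real ^ 'm) \<times> (real ^ 'm \<Rightarrow> real)) list" where
  "payoff_history f h = map (\<lambda>(x, p). (p, \<lambda>q. game f x q)) h"

definition average :: "'a::real_vector list \<Rightarrow> 'a" where
  "average xs = (1 / real (length xs)) *\<^sub>R sum_list xs"

definition primal_game_opt ::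
    "('m::finite \<Rightarrow> 'x::real_vector \<Rightarrow> real) \<Rightarrow> real \<Rightarrow> 'x online_alg \<Rightarrow> (nat \<Rightarrow> ereal) \<Rightarrow>
     ('x \<Rightarrow> 'm option) \<Rightarrow> (('x, real ^ 'm) result \<times> nat) option" where
  "primal_game_opt f \<epsilon> A \<rho> sep =
     map_option
       (\<lambda>(h, r, N). (case r of Some s \<Rightarrow> s | None \<Rightarrow> Dual (average (map snd h)), N))
       (while_option
          (\<lambda>(h, r, N). r = None \<and> \<rho> (length h) \<ge> ereal (\<epsilon> * real (length h)))
          (\<lambda>(h, r, N).
             let x = A (cost_history f h) in
             case sep x of
               None \<Rightarrow> (h, Some (Primal x), Suc N)
             | Some j \<Rightarrow> (h @ [(x, axis j 1)], None, Suc N))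
          ([], None, 0))"

definition dual_game_opt ::
    "('m::finite \<Rightarrow> 'x::real_vector \<Rightarrow> real) \<Rightarrow> real \<Rightarrow> (real ^ 'm) online_alg \<Rightarrow> (nat \<Rightarrow> ereal) \<Rightarrow>
     (real ^ 'm \<Rightarrow> 'x option) \<Rightarrow> (('x, real ^ 'm) result \<times> nat) option" where
  "dual_game_opt f \<epsilon> B \<rho> opt =
     map_option
       (\<lambda>(h, r, N). (case r of Some s \<Rightarrow> s | None \<Rightarrow> Primal (average (map fst h)), N))
       (while_option
          (\<lambda>(h, r, N). r = None \<and> \<rho> (length h) \<ge> ereal (\<epsilon> * real (length h)))
          (\<lambda>(h, r, N).
             let p = B (payoff_history f h) in
             case opt p of
               None \<Rightarrow> (h, Some (Dual p), Suc N)
             | Some x \<Rightarrow> (h @ [(x, p)], None, Suc N))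
          ([], None, 0))"

definition primal_dual_game_opt ::
    "('m::finite \<Rightarrow> 'x::real_vector \<Rightarrow> real) \<Rightarrow> 'x set \<Rightarrow> real \<Rightarrow> 'x online_alg \<Rightarrow>
     (real ^ 'm) online_alg \<Rightarrow> (nat \<Rightarrow> ereal) \<Rightarrow> (('x, real ^ 'm) result \<times> nat) option" where
  "primal_dual_game_opt f P \<epsilon> A B \<rho> =
     map_option
       (\<lambda>(h, N).
          (if approx_solution f P \<epsilon> (average (map fst h)) then Primal (average (map fst h))
           else Dual (average (map snd h)), N))
       (while_option
          (\<lambda>(h, N). \<rho> (length h) \<ge> ereal (\<epsilon> / 2 * real (length h)))
          (\<lambda>(h, N). (h @ [(A (cost_history f h), B (payoff_history f h))], Suc N))
          ([], 0))"

definition dual_certificate ::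
    "('m::finite \<Rightarrow> 'x \<Rightarrow> real) \<Rightarrow> 'x set \<Rightarrow> real \<Rightarrow> real ^ 'm \<Rightarrow> bool" where
  "dual_certificate f P b p \<longleftrightarrow> p \<in> prob_simplex \<and> (\<forall>x\<in>P. game f x p > b)"

end

theory Submission
  imports Defs
begin

text \<open>
  The meta-algorithms play the zero-sum game \<open>g\<close> with at least one player using OnlineAlg.
  When the loop is left at \<open>T\<close>, the regret bound compares the value of the play with that of any fixed
  opponent strategy, up to \<open>\<epsilon>T\<close>. In the primal version each round has value \<open>> \<epsilon>\<close>, so the averaged
  \<open>p\<close> has \<open>g(x,p) > 0\<close> for every \<open>x\<close>; in the dual version each round has value \<open>\<le> 0\<close>, so by convexity
  the averaged \<open>x\<close> has \<open>f\<^sub>j(x) < \<epsilon>\<close>; in the primal-dual version the two bounds, each with \<open>\<epsilon>/2\<close>, are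
  added and the value of the play cancels. In the feasible case the primal loop cannot even complete
  \<open>T\<close> rounds when the regret at \<open>T\<close> is \<open>\<le> \<epsilon>T\<close>, since a feasible point has cost \<open>\<le> 0\<close> in each round.
\<close>

section \<open>Averages\<close>

text \<open>Multiplied out instead of divided, the identity covers the empty list as well, where
  both sides vanish. \<open>game_average\<close> inherits this form.\<close>

lemma sum_list_average:
  "length xs *\<^sub>R average xs = sum_list xs"
  by (cases "xs = []") (auto simp: average_def)

text \<open>Exhibits the average as a convex combination with equal weights, the form to which
  \<open>convex_sum\<close> and \<open>convex_on_sum\<close> apply.\<close>

lemma average_conv_sum:
  "average xs = (\<Sum>i<length xs. (1 / real (length xs)) *\<^sub>R xs ! i)"
  by (simp add: average_def sum_list_sum_nth scaleR_sum_right atLeast0LessThan)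

lemma average_mem_convex:
  assumes "convex K" "set xs \<subseteq> K" "xs \<noteq> []"
  shows "average xs \<in> K"
  unfolding average_conv_sum
  using assms by (intro convex_sum) (auto simp: subset_iff)

text \<open>Jensen's inequality with equal weights, multiplied by the length so that it can be
  compared directly with the accumulated sums in the regret bounds.\<close>

lemma convex_on_average_le:
  assumes "convex_on K \<phi>" "set xs \<subseteq> K" "xs \<noteq> []"
  shows "real (length xs) * \<phi> (average xs) \<le> (\<Sum>x\<leftarrow>xs. \<phi> x)"
proof -
  have "\<phi> (average xs) \<le> (\<Sum>i<length xs. (1 / real (length xs)) * \<phi> (xs ! i))"
    unfolding average_conv_sum
    using assms by (intro convex_on_sum[where C = K]) (auto simp: subset_iff)
  also have "\<dots> = (\<Sum>x\<leftarrow>xs. \<phi> x) / real (length xs)"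
    by (simp add: sum_list_sum_nth atLeast0LessThan sum_divide_distrib)
  finally show ?thesis
    using assms(3) by (simp add: field_simps)
qed

text \<open>The payoff is linear in the weights, so averaging \<open>p\<close> costs nothing: there
  is equality here, whereas averaging \<open>x\<close> gives only Jensen's inequality.\<close>

lemma game_average:
  "real (length ps) * game f x (average ps) = (\<Sum>p\<leftarrow>ps. game f x p)"
proof -
  have lin: "game f x (sum_list qs) = (\<Sum>q\<leftarrow>qs. game f x q)" for qs
    by (induction qs) (auto simp: game_def algebra_simps sum.distrib)
  have "real (length ps) * game f x (average ps) = game f x (length ps *\<^sub>R average ps)"
    by (simp add: game_def sum_distrib_left mult.assoc)
  then show ?thesis
    by (simp only: sum_list_average lin)
qed

section \<open>The simplex of dual weights and the payoff on it\<close>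

lemma convex_prob_simplex: "convex (prob_simplex :: (real ^ 'm::finite) set)"
  unfolding convex_def prob_simplex_def
  by (auto simp: sum.distrib simp flip: sum_distrib_left)

lemma axis_in_prob_simplex: "axis j 1 \<in> (prob_simplex :: (real ^ 'm::finite) set)"
  by (auto simp: prob_simplex_def axis_def)

lemma game_axis: "game f x (axis j 1) = f j x"
proof -
  have "game f x (axis j 1) = (\<Sum>i\<in>UNIV. if i = j then f i x else 0)"
    unfolding game_def by (rule sum.cong) (auto simp: axis_def)
  then show ?thesis by simp
qed

text \<open>A convex combination of numbers at most \<open>b\<close> is at most \<open>b\<close>. It
  bounds the cost of a feasible point, with \<open>b = 0\<close>, and read backwards it yields a
  violated constraint from a dual certificate.\<close>

lemma game_le:
  assumes "p \<in> prob_simplex" "\<And>j. f j x \<le> b"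
  shows "game f x p \<le> b"
proof -
  have "game f x p \<le> (\<Sum>j\<in>UNIV. p $ j * b)"
    unfolding game_def using assms by (intro sum_mono mult_left_mono) (auto simp: prob_simplex_def)
  also have "\<dots> = b"
    using assms(1) by (simp add: prob_simplex_def flip: sum_distrib_right)
  finally show ?thesis .
qed

section \<open>Regret\<close>

text \<open>The infimum over \<open>K\<close> is at most the total cost of the particular comparator
  \<open>z\<close>, and \<open>cs\<close> is one of the sequences in the supremum. This turns a
  bound on the regret into an inequality between real sums.\<close>

lemma cost_regret_ge:
  assumes "set cs \<subseteq> C" "z \<in> K"
  shows "ereal (incurred A cs - (\<Sum>c\<leftarrow>cs. c z)) \<le> cost_regret A K C (length cs)"
proof -
  have "ereal (incurred A cs - (\<Sum>c\<leftarrow>cs. c z)) \<le> ereal (incurred A cs) - (INF z\<in>K. ereal (\<Sum>c\<leftarrow>cs. c z))"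
    unfolding ereal_minus(1)[symmetric]
    by (intro ereal_minus_mono INF_lower assms) simp
  also have "\<dots> \<le> cost_regret A K C (length cs)"
    unfolding cost_regret_def using assms(1) by (intro SUP_upper) auto
  finally show ?thesis .
qed

lemma payoff_regret_ge:
  assumes "set cs \<subseteq> C" "z \<in> K"
  shows "ereal ((\<Sum>c\<leftarrow>cs. c z) - incurred A cs) \<le> payoff_regret A K C (length cs)"
proof -
  have "ereal ((\<Sum>c\<leftarrow>cs. c z) - incurred A cs) \<le> (SUP z\<in>K. ereal (\<Sum>c\<leftarrow>cs. c z)) - ereal (incurred A cs)"
    unfolding ereal_minus(1)[symmetric]
    by (intro ereal_minus_mono SUP_upper assms) simp
  also have "\<dots> \<le> payoff_regret A K C (length cs)"
    unfolding payoff_regret_def using assms(1) by (intro SUP_upper) auto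
  finally show ?thesis .
qed

section \<open>Transcripts and the regret of the empty sequence\<close>

lemma transcript_Nil [simp]: "transcript A [] = []"
  by (simp add: transcript_def)

lemma transcript_snoc [simp]:
  "transcript A (cs @ [c]) = transcript A cs @ [(A (transcript A cs), c)]"
  by (simp add: transcript_def)

text \<open>On the empty sequence nothing is incurred and any comparator pays 0. Hence a loop whose
  guard fails has completed at least one round, and the average that it returns is a genuine one.
  For empty \<open>K\<close> the infimum would be infinite and the regret negative.\<close>

lemma cost_regret_0_nonneg: "K \<noteq> {} \<Longrightarrow> 0 \<le> cost_regret A K C 0"
  using cost_regret_ge[of "[]" C _ K A] by (auto simp: incurred_def zero_ereal_def)

lemma payoff_regret_0_nonneg: "K \<noteq> {} \<Longrightarrow> 0 \<le> payoff_regret A K C 0"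
  using payoff_regret_ge[of "[]" C _ K A] by (auto simp: incurred_def zero_ereal_def)

text \<open>The first positive time at which the loop guard fails. Unlike in
  \<open>regret_time\<close> the inequality is strict, being the negation of the guard. All
  iteration counts are bounded by this number first.\<close>

definition stop_time :: "(nat \<Rightarrow> ereal) \<Rightarrow> real \<Rightarrow> nat" where
  "stop_time \<rho> \<theta> = (LEAST T. 1 \<le> T \<and> \<rho> T < ereal (\<theta> * real T))"

text \<open>The primal-dual loop watches two algorithms through one guard on the larger regret.
  Division by a positive \<open>T\<close> is monotone and so commutes with \<open>max\<close>, and
  \<open>max\<close> is continuous.\<close>

lemma low_regret_max:
  assumes "low_regret \<rho>" "low_regret \<sigma>"
  shows "low_regret (\<lambda>T. max (\<rho> T) (\<sigma> T))"
proof -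
  have "(\<lambda>T. max (\<rho> T / ereal (real T)) (\<sigma> T / ereal (real T))) \<longlonglongrightarrow> max 0 0"
    using assms unfolding low_regret_def by (rule tendsto_max)
  moreover have "\<forall>\<^sub>F T in sequentially.
      max (\<rho> T / ereal (real T)) (\<sigma> T / ereal (real T)) = max (\<rho> T) (\<sigma> T) / ereal (real T)"
    using eventually_gt_at_top[of 0]
  proof eventually_elim
    case (elim T)
    then have "mono (\<lambda>a. a / ereal (real T))"
      by (intro monoI ereal_divide_right_mono) auto
    from max_of_mono[OF this] show ?case by simp
  qed
  ultimately show ?thesis
    unfolding low_regret_def by (simp cong: filterlim_cong add: tendsto_cong)
qed

text \<open>The quotient of regret and time tends to 0, so it is eventually below
  \<open>\<delta>\<close>; at some such \<open>T \<ge> 1\<close> one may multiply by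
  \<open>T\<close>. The strict form serves both \<open>stop_time\<close> and
  \<open>regret_time\<close>.\<close>

lemma low_regret_time_exists:
  assumes "low_regret \<rho>" "\<delta> > 0"
  shows "\<exists>T\<ge>1. \<rho> T < ereal (\<delta> * real T)"
proof -
  have "\<forall>\<^sub>F T in sequentially. \<rho> T / ereal (real T) < ereal \<delta>"
    using assms unfolding low_regret_def by (auto intro: order_tendstoD)
  then have "\<forall>\<^sub>F T in sequentially. 1 \<le> T \<and> \<rho> T / ereal (real T) < ereal \<delta>"
    using eventually_ge_at_top[of 1] by (rule eventually_conj[rotated])
  then obtain T where T: "1 \<le> T" "\<rho> T / ereal (real T) < ereal \<delta>"
    using eventually_happens by force
  then have "\<rho> T < ereal \<delta> * ereal (real T)"
    by (subst (asm) ereal_divide_less_iff) (auto simp: mult.commute)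
  with T(1) show ?thesis by auto
qed

lemma stop_time:
  assumes "low_regret \<rho>" "\<theta> > 0"
  shows "1 \<le> stop_time \<rho> \<theta>" "\<rho> (stop_time \<rho> \<theta>) < ereal (\<theta> * real (stop_time \<rho> \<theta>))"
  using LeastI_ex[OF low_regret_time_exists[OF assms, unfolded Bex_def]]
  by (auto simp: stop_time_def)

lemma regret_time:
  assumes "low_regret \<rho>" "\<delta> > 0"
  shows "1 \<le> regret_time \<rho> \<delta>" "\<rho> (regret_time \<rho> \<delta>) \<le> ereal (\<delta> * real (regret_time \<rho> \<delta>))"
proof -
  have "\<exists>T. 1 \<le> T \<and> \<rho> T \<le> ereal (\<delta> * real T)"
    using low_regret_time_exists[OF assms] by (auto intro: less_imp_le)
  from LeastI_ex[OF this]
  show "1 \<le> regret_time \<rho> \<delta>" "\<rho> (regret_time \<rho> \<delta>) \<le> ereal (\<delta> * real (regret_time \<rho> \<delta>))"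
    by (auto simp: regret_time_def)
qed

text \<open>Both clauses follow from the minimality of \<open>stop_time\<close>. A regret time for
  \<open>\<theta>\<close> with strict inequality is itself a candidate. So is the regret time
  \<open>T\<close> for any \<open>\<delta> < \<theta>\<close>, since
  \<open>\<delta> * T < \<theta> * T\<close> by \<open>T \<ge> 1\<close>.\<close>

lemma within_regret_time_stop_time:
  assumes "low_regret \<rho>" "\<theta> > 0" "N \<le> stop_time \<rho> \<theta>"
  shows "within_regret_time \<rho> \<theta> N"
proof -
  have stop_le: "stop_time \<rho> \<theta> \<le> T" if "1 \<le> T" "\<rho> T < ereal (\<theta> * real T)" for T
    unfolding stop_time_def using that by (intro Least_le) auto
  have "stop_time \<rho> \<theta> \<le> regret_time \<rho> \<delta>" if "0 < \<delta>" "\<delta> < \<theta>" for \<delta>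
  proof (rule stop_le)
    note rt = regret_time[OF assms(1) that(1)]
    show "1 \<le> regret_time \<rho> \<delta>" by (fact rt)
    have "ereal (\<delta> * real (regret_time \<rho> \<delta>)) < ereal (\<theta> * real (regret_time \<rho> \<delta>))"
      using that rt(1) by simp
    with rt(2) show "\<rho> (regret_time \<rho> \<delta>) < ereal (\<theta> * real (regret_time \<rho> \<delta>))"
      by (rule le_less_trans)
  qed
  with stop_le[OF regret_time(1)[OF assms(1,2)]] show ?thesis
    unfolding within_regret_time_def using assms(3) by (meson order_trans)
qed

section \<open>Plays of the game\<close>

text \<open>Expresses that the points in \<open>h\<close> are the moves of \<open>A\<close> against
  the costs induced by the weights in \<open>h\<close>: the history shown to \<open>A\<close> is its
  own transcript. How the weights arise is left open, so the notion serves the primal and the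
  primal-dual loop alike. \<open>payoff_play\<close> is its mirror image for the maximizing
  player.\<close>

definition cost_play ::
    "('m::finite \<Rightarrow> 'x \<Rightarrow> real) \<Rightarrow> 'x online_alg \<Rightarrow> 'x set \<Rightarrow> ('x \<times> (real ^ 'm)) list \<Rightarrow> bool" where
  "cost_play f A P h \<longleftrightarrow> set h \<subseteq> P \<times> prob_simplex \<and>
     cost_history f h = transcript A (map (\<lambda>(x, p) y. game f y p) h)"

definition payoff_play ::
    "('m::finite \<Rightarrow> 'x \<Rightarrow> real) \<Rightarrow> (real ^ 'm) online_alg \<Rightarrow> 'x set \<Rightarrow>
     ('x \<times> (real ^ 'm)) list \<Rightarrow> bool" where
  "payoff_play f B P h \<longleftrightarrow> set h \<subseteq> P \<times> prob_simplex \<and>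
     payoff_history f h = transcript B (map (\<lambda>(x, p) q. game f x q) h)"

text \<open>One number with two readings: the total cost of the minimizing player and the total
  payoff of the maximizing one. This is why it cancels when both regret bounds are added.\<close>

definition play_value :: "('m::finite \<Rightarrow> 'x \<Rightarrow> real) \<Rightarrow> ('x \<times> (real ^ 'm)) list \<Rightarrow> real" where
  "play_value f h = (\<Sum>(x, p)\<leftarrow>h. game f x p)"

lemma cost_play_Nil: "cost_play f A P []"
  by (simp add: cost_play_def cost_history_def)

lemma payoff_play_Nil: "payoff_play f B P []"
  by (simp add: payoff_play_def payoff_history_def)

text \<open>The recorded history consists of points of \<open>P\<close> and admissible costs, on
  which an online algorithm must answer inside \<open>P\<close>. Applied to the empty play, this
  also shows that \<open>P\<close> is nonempty.\<close>

lemma cost_play_move: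
  assumes "online_algorithm A P F" "\<And>p. p \<in> prob_simplex \<Longrightarrow> (\<lambda>x. game f x p) \<in> F"
    and "cost_play f A P h"
  shows "A (cost_history f h) \<in> P"
proof -
  have "set h \<subseteq> P \<times> prob_simplex"
    using assms(3) by (simp add: cost_play_def)
  then have "set (cost_history f h) \<subseteq> P \<times> F"
    using assms(2) by (auto simp: cost_history_def)
  with assms(1) show ?thesis by (auto simp: online_algorithm_def)
qed

lemma payoff_play_move:
  assumes "online_algorithm B prob_simplex G" "\<And>x. x \<in> P \<Longrightarrow> (\<lambda>p. game f x p) \<in> G"
    and "payoff_play f B P h"
  shows "B (payoff_history f h) \<in> prob_simplex"
proof -
  have "set h \<subseteq> P \<times> prob_simplex"
    using assms(3) by (simp add: payoff_play_def)
  then have "set (payoff_history f h) \<subseteq> prob_simplex \<times> G"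
    using assms(2) by (auto simp: payoff_history_def)
  with assms(1) show ?thesis by (auto simp: online_algorithm_def)
qed

lemma cost_play_snoc:
  assumes "cost_play f A P h" "A (cost_history f h) \<in> P" "p \<in> prob_simplex"
  shows "cost_play f A P (h @ [(A (cost_history f h), p)])"
  using assms by (simp add: cost_play_def) (simp add: cost_history_def)

lemma payoff_play_snoc:
  assumes "payoff_play f B P h" "x \<in> P" "B (payoff_history f h) \<in> prob_simplex"
  shows "payoff_play f B P (h @ [(x, B (payoff_history f h))])"
  using assms by (simp add: payoff_play_def) (simp add: payoff_history_def)

text \<open>Along a cost play the amount incurred by \<open>A\<close> is the value of the play, so
  \<open>cost_regret_ge\<close> compares that value with the fixed point \<open>z\<close>.\<close>

lemma cost_play_regret:
  assumes "\<And>p. p \<in> prob_simplex \<Longrightarrow> (\<lambda>x. game f x p) \<in> F"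
    and "cost_play f A P h" "z \<in> P"
  shows "ereal (play_value f h - (\<Sum>p\<leftarrow>map snd h. game f z p)) \<le> cost_regret A P F (length h)"
proof -
  let ?cs = "map (\<lambda>(x, p) y. game f y p) h"
  have "incurred A ?cs = (\<Sum>(x, c)\<leftarrow>cost_history f h. c x)"
    using assms(2) by (simp add: incurred_def cost_play_def)
  also have "\<dots> = play_value f h"
    by (simp add: cost_history_def play_value_def comp_def case_prod_unfold)
  finally have "incurred A ?cs = play_value f h" .
  moreover have "(\<Sum>c\<leftarrow>?cs. c z) = (\<Sum>p\<leftarrow>map snd h. game f z p)"
    by (simp add: comp_def case_prod_unfold)
  moreover have "set ?cs \<subseteq> F"
    using assms(1,2) by (auto simp: cost_play_def)
  ultimately show ?thesis
    using cost_regret_ge[of ?cs F z P A] assms(3) by simp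
qed

text \<open>The comparator is the vertex \<open>axis j 1\<close>, whose payoff against
  \<open>x\<close> is \<open>f j x\<close>. Each constraint is thus bounded separately.\<close>

lemma payoff_play_regret:
  assumes "\<And>x. x \<in> P \<Longrightarrow> (\<lambda>p. game f x p) \<in> G"
    and "payoff_play f B P h"
  shows "ereal ((\<Sum>x\<leftarrow>map fst h. f j x) - play_value f h) \<le> payoff_regret B prob_simplex G (length h)"
proof -
  let ?cs = "map (\<lambda>(x, p) q. game f x q) h"
  have "incurred B ?cs = (\<Sum>(p, c)\<leftarrow>payoff_history f h. c p)"
    using assms(2) by (simp add: incurred_def payoff_play_def)
  also have "\<dots> = play_value f h"
    by (simp add: payoff_history_def play_value_def comp_def case_prod_unfold)
  finally have "incurred B ?cs = play_value f h" .
  moreover have "(\<Sum>c\<leftarrow>?cs. c (axis j 1)) = (\<Sum>x\<leftarrow>map fst h. f j x)"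
    by (simp add: comp_def case_prod_unfold game_axis)
  moreover have "set ?cs \<subseteq> G"
    using assms(1,2) by (auto simp: payoff_play_def)
  ultimately show ?thesis
    using payoff_regret_ge[of ?cs G "axis j 1" prob_simplex B] by (simp add: axis_in_prob_simplex)
qed

lemma average_fst_mem:
  assumes "convex P" "set h \<subseteq> P \<times> Q" "h \<noteq> []"
  shows "average (map fst h) \<in> P"
  using assms by (intro average_mem_convex) auto

lemma average_snd_mem:
  assumes "convex Q" "set h \<subseteq> P \<times> Q" "h \<noteq> []"
  shows "average (map snd h) \<in> Q"
  using assms by (intro average_mem_convex) auto

section \<open>The three meta-algorithms\<close>

text \<open>Termination and the invariant rule in one: \<open>\<tau> - count s\<close> is a
  decreasing measure, because the counter grows by one in each pass and is still below
  \<open>\<tau>\<close> when a pass begins.\<close>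

lemma bounded_while_option:
  fixes count :: "'s \<Rightarrow> nat"
  assumes "I s\<^sub>0"
    and "\<And>s. I s \<Longrightarrow> b s \<Longrightarrow> I (c s) \<and> count s < \<tau> \<and> count (c s) = Suc (count s)"
  obtains s where "while_option b c s\<^sub>0 = Some s" "I s" "\<not> b s"
proof -
  have "\<exists>s. while_option b c s\<^sub>0 = Some s"
  proof (rule measure_while_option_Some[where P = I and f = "\<lambda>s. \<tau> - count s"])
    show "I (c s) \<and> \<tau> - count (c s) < \<tau> - count s" if "I s" "b s" for s
      using assms(2)[OF that] by auto
  qed (fact assms(1))
  then obtain s where s: "while_option b c s\<^sub>0 = Some s" ..
  have "I s"
    using while_option_rule[where P = I, OF _ s assms(1)] assms(2) by blast
  then show ?thesis
    using s while_option_stop[OF s] that by blast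
qed

text \<open>Feasibility is not decided here: the outcome is a certificate or an approximate solution
  in any case, and the case distinction is left to the end. Feasibility enters only the sharper
  iteration bound, which holds even if the regret inequality is an equality at the regret
  time.\<close>

lemma primal_game_opt:
  fixes f :: "'m::finite \<Rightarrow> 'x::real_vector \<Rightarrow> real"
  assumes \<epsilon>: "\<epsilon> > 0"
    and F: "\<And>p. p \<in> prob_simplex \<Longrightarrow> (\<lambda>x. game f x p) \<in> F"
    and A: "online_algorithm A P F"
    and low: "low_regret (cost_regret A P F)"
    and sep: "separation_oracle f P \<epsilon> sep"
  obtains s N where "primal_game_opt f \<epsilon> A (cost_regret A P F) sep = Some (s, N)"
    "(\<exists>p. s = Dual p \<and> dual_certificate f P 0 p) \<or> (\<exists>x. s = Primal x \<and> approx_solution f P \<epsilon> x)"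
    "feasible f P \<longrightarrow> N \<le> regret_time (cost_regret A P F) \<epsilon>"
    "within_regret_time (cost_regret A P F) \<epsilon> N"
proof -
  let ?\<rho> = "cost_regret A P F"
  let ?\<tau> = "stop_time ?\<rho> \<epsilon>"
  let ?b = "\<lambda>(h, r, N). r = None \<and> ?\<rho> (length h) \<ge> ereal (\<epsilon> * real (length h))"
  let ?c = "\<lambda>(h, r :: ('x, real ^ 'm) result option, N).
             let x = A (cost_history f h) in
             case sep x of
               None \<Rightarrow> (h, Some (Primal x), Suc N)
             | Some j \<Rightarrow> (h @ [(x, axis j 1)], None, Suc N)"
  \<comment> \<open>The pass in which the oracle answers FAIL counts as an iteration but adds no
    round, so \<open>N = length h\<close> is claimed only while \<open>r = None\<close>. The strict
    bound on the play value is false for the empty play, hence the alternative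
    \<open>h = []\<close>.\<close>
  define Inv where "Inv = (\<lambda>(h, r :: ('x, real ^ 'm) result option, N).
      cost_play f A P h \<and> (h = [] \<or> play_value f h > \<epsilon> * real (length h)) \<and>
      (r = None \<longrightarrow> N = length h) \<and>
      (\<forall>s. r = Some s \<longrightarrow> (\<exists>x. s = Primal x \<and> approx_solution f P \<epsilon> x)) \<and>
      N \<le> ?\<tau> \<and> (feasible f P \<longrightarrow> N \<le> regret_time ?\<rho> \<epsilon>))"
  note st = stop_time[OF low \<epsilon>] and rt = regret_time[OF low \<epsilon>]
  have "P \<noteq> {}"
    using cost_play_move[OF A F cost_play_Nil] by blast
  have start: "Inv ([], None, 0)"
    by (simp add: Inv_def cost_play_Nil)
  have step: "Inv (?c s) \<and> snd (snd s) < ?\<tau> \<and> snd (snd (?c s)) = Suc (snd (snd s))"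
    if inv: "Inv s" and guard: "?b s" for s
  proof -
    obtain h N where s: "s = (h, None, N)" using guard by (cases s) auto
    have h: "cost_play f A P h" "h = [] \<or> play_value f h > \<epsilon> * real (length h)"
      and N: "N = length h" "N \<le> ?\<tau>" "feasible f P \<Longrightarrow> N \<le> regret_time ?\<rho> \<epsilon>"
      using inv by (auto simp: Inv_def s)
    \<comment> \<open>The guard holds after \<open>N\<close> rounds but fails at
      \<open>stop_time\<close>. The resulting strict inequality leaves room for the present pass,
      even if it is the one that returns.\<close>
    have "N \<noteq> ?\<tau>"
      using guard st(2) N(1) by (auto simp: s)
    with N have less: "N < ?\<tau>" by simp
    have less': "N < regret_time ?\<rho> \<epsilon>" if feas: "feasible f P"
    proof -
      obtain z where z: "z \<in> P" "\<And>j. f j z \<le> 0"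
        using feas by (auto simp: feasible_def)
      \<comment> \<open>At the regret time the play value would exceed the total cost of
        \<open>z\<close>, which is at most 0, by at most \<open>\<epsilon> * N\<close>. Yet at least
        one round has been played, so the play value is strictly larger than
        \<open>\<epsilon> * N\<close>.\<close>
      have "N \<noteq> regret_time ?\<rho> \<epsilon>"
      proof
        assume eq: "N = regret_time ?\<rho> \<epsilon>"
        have "(\<Sum>p\<leftarrow>map snd h. game f z p) \<le> 0"
          using h(1) z(2) by (intro sum_list_nonpos) (auto simp: cost_play_def intro!: game_le)
        moreover have "ereal (play_value f h - (\<Sum>p\<leftarrow>map snd h. game f z p)) \<le> ereal (\<epsilon> * real N)"
          using cost_play_regret[OF F h(1) z(1)] rt(2) unfolding N(1)[symmetric] eq[symmetric]
          by (rule order_trans)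
        moreover have "h \<noteq> []" using rt(1) eq N(1) by auto
        ultimately show False using h(2) N(1) by auto
      qed
      with N(3)[OF feas] show ?thesis by simp
    qed
    define x where "x = A (cost_history f h)"
    have x: "x \<in> P"
      using cost_play_move[OF A F h(1)] by (simp add: x_def)
    show ?thesis
    proof (cases "sep x")
      case None
      then have "approx_solution f P \<epsilon> x"
        using sep x by (force simp: separation_oracle_def approx_solution_def not_less)
      with None show ?thesis
        using h N(1) less less' by (auto simp: s Inv_def Let_def simp flip: x_def)
    next
      case (Some j)
      then have j: "f j x > \<epsilon>"
        using sep x by (force simp: separation_oracle_def)
      have "cost_play f A P (h @ [(x, axis j 1)])"
        using cost_play_snoc[OF h(1) _ axis_in_prob_simplex] x by (simp add: x_def)
      moreover have "play_value f (h @ [(x, axis j 1)]) > \<epsilon> * real (length (h @ [(x, axis j 1 :: real ^ 'm)]))"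
        using h(2) j by (auto simp: play_value_def game_axis algebra_simps)
      ultimately show ?thesis
        using Some N(1) less less' by (auto simp: s Inv_def Let_def simp flip: x_def)
    qed
  qed
  obtain final where final: "while_option ?b ?c ([], None, 0) = Some final" "Inv final" "\<not> ?b final"
    by (rule bounded_while_option[where I = Inv and count = "\<lambda>s. snd (snd s)" and b = ?b and c = ?c, OF start step])
  obtain h r N where eq: "final = (h, r, N)"
    by (cases final)
  note w = final(1)[unfolded eq] and inv = final(2)[unfolded eq] and stop = final(3)[unfolded eq]
  show ?thesis
  proof (rule that)
    show "primal_game_opt f \<epsilon> A ?\<rho> sep =
        Some (case r of Some s \<Rightarrow> s | None \<Rightarrow> Dual (average (map snd h)), N)"
      unfolding primal_game_opt_def w by simp
    show "feasible f P \<longrightarrow> N \<le> regret_time ?\<rho> \<epsilon>"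
      using inv by (simp add: Inv_def)
    show "within_regret_time ?\<rho> \<epsilon> N"
      using inv by (intro within_regret_time_stop_time low \<epsilon>) (simp add: Inv_def)
    show "(\<exists>p. (case r of Some s \<Rightarrow> s | None \<Rightarrow> Dual (average (map snd h))) = Dual p \<and> dual_certificate f P 0 p) \<or>
        (\<exists>x. (case r of Some s \<Rightarrow> s | None \<Rightarrow> Dual (average (map snd h))) = Primal x \<and> approx_solution f P \<epsilon> x)"
    proof (cases r)
      case (Some s)
      with inv show ?thesis by (auto simp: Inv_def)
    next
      case None
      with stop have exit: "?\<rho> (length h) < ereal (\<epsilon> * real (length h))" by auto
      have "h \<noteq> []"
        using exit cost_regret_0_nonneg[OF \<open>P \<noteq> {}\<close>, of A F] by (auto simp flip: zero_ereal_def)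
      with inv have h: "cost_play f A P h" "play_value f h > \<epsilon> * real (length h)"
        by (auto simp: Inv_def)
      have "game f x (average (map snd h)) > 0" if "x \<in> P" for x
      proof -
        have "ereal (play_value f h - (\<Sum>p\<leftarrow>map snd h. game f x p)) < ereal (\<epsilon> * real (length h))"
          using cost_play_regret[OF F h(1) that] exit by (rule le_less_trans)
        with h(2) have "0 < (\<Sum>p\<leftarrow>map snd h. game f x p)" by simp
        also have "\<dots> = real (length h) * game f x (average (map snd h))"
          using game_average[of "map snd h" f x] by simp
        finally show ?thesis by (simp add: zero_less_mult_iff)
      qed
      moreover have "average (map snd h) \<in> prob_simplex"
        using h(1) \<open>h \<noteq> []\<close> by (intro average_snd_mem[OF convex_prob_simplex]) (auto simp: cost_play_def)
      ultimately show ?thesis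
        using None by (simp add: dual_certificate_def)
    qed
  qed
qed

text \<open>While the oracle answers, the play value stays at most 0; if it fails, the current
  weights are themselves a certificate. On a regular exit the regret against each vertex bounds the
  sum of \<open>f j\<close> over the rounds, and Jensen's inequality passes to the averaged
  point.\<close>

lemma dual_game_opt:
  fixes f :: "'m::finite \<Rightarrow> 'x::real_vector \<Rightarrow> real"
  assumes P: "convex P" and f: "\<And>j. convex_on P (f j)"
    and \<epsilon>: "\<epsilon> > 0"
    and G: "\<And>x. x \<in> P \<Longrightarrow> (\<lambda>p. game f x p) \<in> G"
    and B: "online_algorithm B prob_simplex G"
    and low: "low_regret (payoff_regret B prob_simplex G)"
    and opt: "optimization_oracle f P opt"
  obtains s N where "dual_game_opt f \<epsilon> B (payoff_regret B prob_simplex G) opt = Some (s, N)"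
    "(\<exists>p. s = Dual p \<and> dual_certificate f P 0 p) \<or> (\<exists>x. s = Primal x \<and> approx_solution f P \<epsilon> x)"
    "within_regret_time (payoff_regret B prob_simplex G) \<epsilon> N"
proof -
  let ?\<rho> = "payoff_regret B prob_simplex G"
  let ?\<tau> = "stop_time ?\<rho> \<epsilon>"
  let ?b = "\<lambda>(h, r, N). r = None \<and> ?\<rho> (length h) \<ge> ereal (\<epsilon> * real (length h))"
  let ?c = "\<lambda>(h, r :: ('x, real ^ 'm) result option, N).
             let p = B (payoff_history f h) in
             case opt p of
               None \<Rightarrow> (h, Some (Dual p), Suc N)
             | Some x \<Rightarrow> (h @ [(x, p)], None, Suc N)"
  define Inv where "Inv = (\<lambda>(h, r :: ('x, real ^ 'm) result option, N).
      payoff_play f B P h \<and> play_value f h \<le> 0 \<and>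
      (r = None \<longrightarrow> N = length h) \<and>
      (\<forall>s. r = Some s \<longrightarrow> (\<exists>p. s = Dual p \<and> dual_certificate f P 0 p)) \<and>
      N \<le> ?\<tau>)"
  note st = stop_time[OF low \<epsilon>]
  have start: "Inv ([], None, 0)"
    by (simp add: Inv_def payoff_play_Nil play_value_def)
  have step: "Inv (?c s) \<and> snd (snd s) < ?\<tau> \<and> snd (snd (?c s)) = Suc (snd (snd s))"
    if inv: "Inv s" and guard: "?b s" for s
  proof -
    obtain h N where s: "s = (h, None, N)" using guard by (cases s) auto
    have h: "payoff_play f B P h" "play_value f h \<le> 0"
      and N: "N = length h" "N \<le> ?\<tau>"
      using inv by (auto simp: Inv_def s)
    have "N \<noteq> ?\<tau>"
      using guard st(2) N(1) by (auto simp: s)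
    with N have less: "N < ?\<tau>" by simp
    define p where "p = B (payoff_history f h)"
    have p: "p \<in> prob_simplex"
      using payoff_play_move[OF B G h(1)] by (simp add: p_def)
    show ?thesis
    proof (cases "opt p")
      case None
      then have "dual_certificate f P 0 p"
        using opt p by (force simp: optimization_oracle_def dual_certificate_def not_le)
      with None show ?thesis
        using h less by (auto simp: s Inv_def Let_def simp flip: p_def)
    next
      case (Some x)
      then have x: "x \<in> P" "game f x p \<le> 0"
        using opt p by (force simp: optimization_oracle_def)+
      have "payoff_play f B P (h @ [(x, p)])"
        using payoff_play_snoc[OF h(1) x(1)] p by (simp add: p_def)
      moreover have "play_value f (h @ [(x, p)]) \<le> 0"
        using h(2) x(2) by (simp add: play_value_def)
      ultimately show ?thesis
        using Some N(1) less by (auto simp: s Inv_def Let_def simp flip: p_def)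
    qed
  qed
  obtain final where final: "while_option ?b ?c ([], None, 0) = Some final" "Inv final" "\<not> ?b final"
    by (rule bounded_while_option[where I = Inv and count = "\<lambda>s. snd (snd s)" and b = ?b and c = ?c, OF start step])
  obtain h r N where eq: "final = (h, r, N)"
    by (cases final)
  note w = final(1)[unfolded eq] and inv = final(2)[unfolded eq] and stop = final(3)[unfolded eq]
  show ?thesis
  proof (rule that)
    show "dual_game_opt f \<epsilon> B ?\<rho> opt =
        Some (case r of Some s \<Rightarrow> s | None \<Rightarrow> Primal (average (map fst h)), N)"
      unfolding dual_game_opt_def w by simp
    show "within_regret_time ?\<rho> \<epsilon> N"
      using inv by (intro within_regret_time_stop_time low \<epsilon>) (simp add: Inv_def)
    show "(\<exists>p. (case r of Some s \<Rightarrow> s | None \<Rightarrow> Primal (average (map fst h))) = Dual p \<and> dual_certificate f P 0 p) \<or>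
        (\<exists>x. (case r of Some s \<Rightarrow> s | None \<Rightarrow> Primal (average (map fst h))) = Primal x \<and> approx_solution f P \<epsilon> x)"
    proof (cases r)
      case (Some s)
      with inv show ?thesis by (auto simp: Inv_def)
    next
      case None
      with stop have exit: "?\<rho> (length h) < ereal (\<epsilon> * real (length h))" by auto
      have "(prob_simplex :: (real ^ 'm) set) \<noteq> {}"
        using axis_in_prob_simplex by blast
      then have "h \<noteq> []"
        using exit payoff_regret_0_nonneg[of prob_simplex B G] by (auto simp flip: zero_ereal_def)
      have h: "payoff_play f B P h" "play_value f h \<le> 0"
        using inv by (auto simp: Inv_def)
      then have hP: "set (map fst h) \<subseteq> P"
        by (auto simp: payoff_play_def)
      have "f j (average (map fst h)) \<le> \<epsilon>" for j
      proof -
        have "ereal ((\<Sum>x\<leftarrow>map fst h. f j x) - play_value f h) < ereal (\<epsilon> * real (length h))"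
          using payoff_play_regret[OF G h(1)] exit by (rule le_less_trans)
        then have "(\<Sum>x\<leftarrow>map fst h. f j x) \<le> real (length h) * \<epsilon>"
          using h(2) by (simp add: mult.commute)
        moreover have "real (length h) * f j (average (map fst h)) \<le> (\<Sum>x\<leftarrow>map fst h. f j x)"
          using convex_on_average_le[OF f hP] \<open>h \<noteq> []\<close> by simp
        ultimately have "real (length h) * f j (average (map fst h)) \<le> real (length h) * \<epsilon>"
          by linarith
        then show ?thesis using \<open>h \<noteq> []\<close> by simp
      qed
      moreover have "average (map fst h) \<in> P"
        using hP \<open>h \<noteq> []\<close> by (intro average_mem_convex P) auto
      ultimately show ?thesis
        using None by (simp add: approx_solution_def)
    qed
  qed
qed

text \<open>The dual outcome is obtained with bound 0, which is stronger than the bound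
  \<open>- \<epsilon>\<close> claimed in the end. The guard uses the larger of the two regrets, so
  that on exit both are below half of \<open>\<epsilon>\<close> times the number of rounds.\<close>

lemma primal_dual_game_opt:
  fixes f :: "'m::finite \<Rightarrow> 'x::real_vector \<Rightarrow> real"
  assumes P: "convex P" and f: "\<And>j. convex_on P (f j)"
    and \<epsilon>: "\<epsilon> > 0"
    and F: "\<And>p. p \<in> prob_simplex \<Longrightarrow> (\<lambda>x. game f x p) \<in> F"
    and A: "online_algorithm A P F"
    and lowA: "low_regret (cost_regret A P F)"
    and G: "\<And>x. x \<in> P \<Longrightarrow> (\<lambda>p. game f x p) \<in> G"
    and B: "online_algorithm B prob_simplex G"
    and lowB: "low_regret (payoff_regret B prob_simplex G)"
  defines "\<rho> \<equiv> \<lambda>t. max (cost_regret A P F t) (payoff_regret B prob_simplex G t)"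
  obtains s N where "primal_dual_game_opt f P \<epsilon> A B \<rho> = Some (s, N)"
    "(\<exists>p. s = Dual p \<and> dual_certificate f P 0 p) \<or> (\<exists>x. s = Primal x \<and> approx_solution f P \<epsilon> x)"
    "within_regret_time \<rho> (\<epsilon> / 2) N"
proof -
  have \<epsilon>2: "\<epsilon> / 2 > 0" using \<epsilon> by simp
  have low: "low_regret \<rho>"
    unfolding \<rho>_def by (rule low_regret_max[OF lowA lowB])
  let ?\<tau> = "stop_time \<rho> (\<epsilon> / 2)"
  let ?b = "\<lambda>(h, N). \<rho> (length h) \<ge> ereal (\<epsilon> / 2 * real (length h))"
  let ?c = "\<lambda>(h, N). (h @ [(A (cost_history f h), B (payoff_history f h))], Suc N)"
  define Inv where "Inv = (\<lambda>(h, N).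
      cost_play f A P h \<and> payoff_play f B P h \<and> N = length h \<and> N \<le> ?\<tau>)"
  note st = stop_time[OF low \<epsilon>2]
  have "P \<noteq> {}"
    using cost_play_move[OF A F cost_play_Nil] by blast
  have start: "Inv ([], 0)"
    by (simp add: Inv_def payoff_play_Nil cost_play_Nil)
  have step: "Inv (?c s) \<and> snd s < ?\<tau> \<and> snd (?c s) = Suc (snd s)"
    if inv: "Inv s" and guard: "?b s" for s
  proof -
    obtain h N where s: "s = (h, N)" by (cases s)
    have h: "cost_play f A P h" "payoff_play f B P h" and N: "N = length h" "N \<le> ?\<tau>"
      using inv by (auto simp: Inv_def s)
    have "N \<noteq> ?\<tau>"
      using guard st(2) N(1) by (auto simp: s)
    with N have "N < ?\<tau>" by simp
    \<comment> \<open>Both moves depend on the same past rounds, and the pair of them extends the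
      cost play and the payoff play at once.\<close>
    moreover note x = cost_play_move[OF A F h(1)] and p = payoff_play_move[OF B G h(2)]
    moreover note cost_play_snoc[OF h(1) x p] payoff_play_snoc[OF h(2) x p]
    ultimately show ?thesis
      using N(1) by (auto simp: s Inv_def)
  qed
  obtain final where final: "while_option ?b ?c ([], 0) = Some final" "Inv final" "\<not> ?b final"
    by (rule bounded_while_option[where I = Inv and count = snd and b = ?b and c = ?c, OF start step])
  obtain h N where eq: "final = (h, N)"
    by (cases final)
  note w = final(1)[unfolded eq] and inv = final(2)[unfolded eq] and stop = final(3)[unfolded eq]
  define xa where "xa = average (map fst h)"
  define pa where "pa = average (map snd h)"
  show ?thesis
  proof (rule that)
    show "primal_dual_game_opt f P \<epsilon> A B \<rho> =
        Some (if approx_solution f P \<epsilon> xa then Primal xa else Dual pa, N)"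
      unfolding primal_dual_game_opt_def w xa_def pa_def by simp
    show "within_regret_time \<rho> (\<epsilon> / 2) N"
      using inv by (intro within_regret_time_stop_time low \<epsilon>2) (simp add: Inv_def)
    have exit: "cost_regret A P F (length h) < ereal (\<epsilon> / 2 * real (length h))"
        "payoff_regret B prob_simplex G (length h) < ereal (\<epsilon> / 2 * real (length h))"
      using stop by (simp_all add: \<rho>_def not_le)
    have "h \<noteq> []"
      using exit(1) cost_regret_0_nonneg[OF \<open>P \<noteq> {}\<close>, of A F] by (auto simp flip: zero_ereal_def)
    have h: "cost_play f A P h" "payoff_play f B P h"
      using inv by (auto simp: Inv_def)
    then have hP: "set (map fst h) \<subseteq> P" and hS: "set h \<subseteq> P \<times> prob_simplex"
      by (auto simp: payoff_play_def)
    have xa: "xa \<in> P" and pa: "pa \<in> prob_simplex"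
      using average_fst_mem[OF P hS] average_snd_mem[OF convex_prob_simplex hS] \<open>h \<noteq> []\<close>
      by (auto simp: xa_def pa_def)
    \<comment> \<open>The sum of the two regret bounds, with the play value cancelled and each side
      averaged. Since \<open>j\<close> and \<open>x\<close> are independent, this is an approximate
      saddle point inequality.\<close>
    have gap: "f j xa < game f x pa + \<epsilon>" if "x \<in> P" for j x
    proof -
      have "ereal (play_value f h - (\<Sum>p\<leftarrow>map snd h. game f x p)) < ereal (\<epsilon> / 2 * real (length h))"
        using cost_play_regret[OF F h(1) that] exit(1) by (rule le_less_trans)
      moreover have "ereal ((\<Sum>x\<leftarrow>map fst h. f j x) - play_value f h) < ereal (\<epsilon> / 2 * real (length h))"
        using payoff_play_regret[OF G h(2)] exit(2) by (rule le_less_trans)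
      moreover have "real (length h) * f j xa \<le> (\<Sum>x\<leftarrow>map fst h. f j x)"
        using convex_on_average_le[OF f hP] \<open>h \<noteq> []\<close> by (simp add: xa_def)
      moreover have "real (length h) * game f x pa = (\<Sum>p\<leftarrow>map snd h. game f x p)"
        using game_average[of "map snd h" f x] by (simp add: pa_def)
      ultimately have "real (length h) * f j xa < real (length h) * (game f x pa + \<epsilon>)"
        by (simp add: algebra_simps)
      then show ?thesis
        by (simp add: mult_less_cancel_left)
    qed
    show "(\<exists>p. (if approx_solution f P \<epsilon> xa then Primal xa else Dual pa) = Dual p \<and> dual_certificate f P 0 p) \<or>
        (\<exists>x. (if approx_solution f P \<epsilon> xa then Primal xa else Dual pa) = Primal x \<and> approx_solution f P \<epsilon> x)"
    proof (cases "approx_solution f P \<epsilon> xa")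
      case False
      then obtain j where "f j xa > \<epsilon>"
        using xa by (auto simp: approx_solution_def not_le)
      \<comment> \<open>A constraint violated by more than \<open>\<epsilon>\<close> at
        \<open>xa\<close> absorbs the whole gap.\<close>
      then have "game f x pa > 0" if "x \<in> P" for x
        using gap[OF that, of j] by linarith
      with pa False show ?thesis by (auto simp: dual_certificate_def)
    qed auto
  qed
qed

text \<open>Weak duality: a weighted mean above \<open>b\<close> forces some constraint above
  \<open>b\<close>. With \<open>b = 0\<close> this refutes feasibility, with
  \<open>b = - \<epsilon>\<close> the program tightened by \<open>\<epsilon>\<close>.\<close>

lemma dual_certificate_refutes:
  assumes "dual_certificate f P b p" "x \<in> P"
  shows "\<exists>j. f j x > b"
  using assms game_le[of p f x b] by (auto simp: dual_certificate_def not_le[symmetric])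

theorem theorem5:
  fixes P :: "(real ^ 'n) set"
    and f :: "'m::finite \<Rightarrow> real ^ 'n \<Rightarrow> real"
    and \<epsilon> :: real
    and A :: "(real ^ 'n) online_alg" and F :: "(real ^ 'n \<Rightarrow> real) set"
    and B :: "(real ^ 'm) online_alg" and G :: "(real ^ 'm \<Rightarrow> real) set"
    and sep :: "real ^ 'n \<Rightarrow> 'm option"
    and opt :: "real ^ 'm \<Rightarrow> (real ^ 'n) option"
  assumes "convex P" and "compact P"
    and "\<And>j. convex_on P (f j)"
    and "\<epsilon> > 0"
    and "\<And>c. c \<in> F \<Longrightarrow> convex_on P c"
    and "\<And>p. p \<in> prob_simplex \<Longrightarrow> (\<lambda>x. game f x p) \<in> F"
    and "online_algorithm A P F"
    and "low_regret (cost_regret A P F)"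
    and "\<And>c. c \<in> G \<Longrightarrow> concave_on prob_simplex c"
    and "\<And>x. x \<in> P \<Longrightarrow> (\<lambda>p. game f x p) \<in> G"
    and "online_algorithm B prob_simplex G"
    and "low_regret (payoff_regret B prob_simplex G)"
    and "separation_oracle f P \<epsilon> sep"
    and "optimization_oracle f P opt"
  shows
    "(\<exists>s N. primal_game_opt f \<epsilon> A (cost_regret A P F) sep = Some (s, N) \<and>
       (feasible f P \<longrightarrow> (\<exists>x. s = Primal x \<and> approx_solution f P \<epsilon> x)) \<and>
       (\<not> feasible f P \<longrightarrow>
          (\<exists>p. s = Dual p \<and> dual_certificate f P 0 p) \<or>
          (\<exists>x. s = Primal x \<and> approx_solution f P \<epsilon> x)) \<and>
       ((\<nexists>x. approx_solution f P \<epsilon> x) \<longrightarrow> (\<exists>p. s = Dual p \<and> dual_certificate f P 0 p)) \<and>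
       (feasible f P \<longrightarrow> N \<le> regret_time (cost_regret A P F) \<epsilon>) \<and>
       within_regret_time (cost_regret A P F) \<epsilon> N)
   \<and>
    (\<exists>s N. dual_game_opt f \<epsilon> B (payoff_regret B prob_simplex G) opt = Some (s, N) \<and>
       (feasible f P \<longrightarrow> (\<exists>x. s = Primal x \<and> approx_solution f P \<epsilon> x)) \<and>
       (\<not> feasible f P \<longrightarrow>
          (\<exists>p. s = Dual p \<and> dual_certificate f P 0 p) \<or>
          (\<exists>x. s = Primal x \<and> approx_solution f P \<epsilon> x)) \<and>
       ((\<nexists>x. approx_solution f P \<epsilon> x) \<longrightarrow> (\<exists>p. s = Dual p \<and> dual_certificate f P 0 p)) \<and>
       within_regret_time (payoff_regret B prob_simplex G) \<epsilon> N)
   \<and>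
    (\<exists>s N. primal_dual_game_opt f P \<epsilon> A B
              (\<lambda>t. max (cost_regret A P F t) (payoff_regret B prob_simplex G t)) = Some (s, N) \<and>
       (feasible f P \<longrightarrow> (\<exists>x. s = Primal x \<and> approx_solution f P \<epsilon> x)) \<and>
       (\<not> feasible f P \<longrightarrow>
          (\<exists>p. s = Dual p \<and> dual_certificate f P (- \<epsilon>) p \<and> \<not> (\<exists>x\<in>P. \<forall>j. f j x \<le> - \<epsilon>)) \<or>
          (\<exists>x. s = Primal x \<and> approx_solution f P \<epsilon> x)) \<and>
       ((\<nexists>x. approx_solution f P \<epsilon> x) \<longrightarrow>
          (\<exists>p. s = Dual p \<and> dual_certificate f P (- \<epsilon>) p \<and> \<not> (\<exists>x\<in>P. \<forall>j. f j x \<le> - \<epsilon>))) \<and>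
       within_regret_time
         (\<lambda>t. max (cost_regret A P F t) (payoff_regret B prob_simplex G t)) (\<epsilon> / 2) N)"
proof -
  let ?\<rho> = "cost_regret A P F" and ?\<sigma> = "payoff_regret B prob_simplex G"
  obtain s\<^sub>1 N\<^sub>1 where primal: "primal_game_opt f \<epsilon> A ?\<rho> sep = Some (s\<^sub>1, N\<^sub>1)"
    "(\<exists>p. s\<^sub>1 = Dual p \<and> dual_certificate f P 0 p) \<or> (\<exists>x. s\<^sub>1 = Primal x \<and> approx_solution f P \<epsilon> x)"
    "feasible f P \<longrightarrow> N\<^sub>1 \<le> regret_time ?\<rho> \<epsilon>" "within_regret_time ?\<rho> \<epsilon> N\<^sub>1"
    using assms(4,6,7,8,13) by (rule primal_game_opt) blast
  obtain s\<^sub>2 N\<^sub>2 where dual: "dual_game_opt f \<epsilon> B ?\<sigma> opt = Some (s\<^sub>2, N\<^sub>2)"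
    "(\<exists>p. s\<^sub>2 = Dual p \<and> dual_certificate f P 0 p) \<or> (\<exists>x. s\<^sub>2 = Primal x \<and> approx_solution f P \<epsilon> x)"
    "within_regret_time ?\<sigma> \<epsilon> N\<^sub>2"
    using assms(1,3,4,10,11,12,14) by (rule dual_game_opt) blast
  obtain s\<^sub>3 N\<^sub>3 where both:
    "primal_dual_game_opt f P \<epsilon> A B (\<lambda>t. max (?\<rho> t) (?\<sigma> t)) = Some (s\<^sub>3, N\<^sub>3)"
    "(\<exists>p. s\<^sub>3 = Dual p \<and> dual_certificate f P 0 p) \<or> (\<exists>x. s\<^sub>3 = Primal x \<and> approx_solution f P \<epsilon> x)"
    "within_regret_time (\<lambda>t. max (?\<rho> t) (?\<sigma> t)) (\<epsilon> / 2) N\<^sub>3"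
    using assms(1,3,4,6,7,8,10,11,12) by (rule primal_dual_game_opt) blast
  have infeasible: "\<not> feasible f P" if "dual_certificate f P 0 p" for p
    using dual_certificate_refutes[OF that] by (meson feasible_def not_le)
  have close: "dual_certificate f P (- \<epsilon>) p \<and> \<not> (\<exists>x\<in>P. \<forall>j. f j x \<le> - \<epsilon>)"
    if "dual_certificate f P 0 p" for p
  proof -
    have "dual_certificate f P (- \<epsilon>) p"
      using that \<open>\<epsilon> > 0\<close> by (force simp: dual_certificate_def)
    with dual_certificate_refutes[OF this] show ?thesis by (meson not_le)
  qed
  \<comment> \<open>All three algorithms end in the same dichotomy, with \<open>Q\<close> standing
    for the certificate property claimed. Feasibility excludes the dual alternative, and the lack of
    an approximate solution excludes the primal one; in between, both remain.\<close>
  have outcome: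
    "feasible f P \<longrightarrow> (\<exists>x. s = Primal x \<and> approx_solution f P \<epsilon> x)"
    "\<not> feasible f P \<longrightarrow>
       (\<exists>p. s = Dual p \<and> Q p) \<or> (\<exists>x. s = Primal x \<and> approx_solution f P \<epsilon> x)"
    "(\<nexists>x. approx_solution f P \<epsilon> x) \<longrightarrow> (\<exists>p. s = Dual p \<and> Q p)"
    if "(\<exists>p. s = Dual p \<and> dual_certificate f P 0 p) \<or> (\<exists>x. s = Primal x \<and> approx_solution f P \<epsilon> x)"
      and "\<And>p. dual_certificate f P 0 p \<Longrightarrow> Q p" for s Q
    using that infeasible by blast+
  show ?thesis
  proof (intro conjI, goal_cases)
    case 1
    show ?case
      by (rule exI[of _ s\<^sub>1], rule exI[of _ N\<^sub>1], intro conjI primal(1,3,4) outcome[OF primal(2)])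
  next
    case 2
    show ?case
      by (rule exI[of _ s\<^sub>2], rule exI[of _ N\<^sub>2], intro conjI dual(1,3) outcome[OF dual(2)])
  next
    case 3
    show ?case
      by (rule exI[of _ s\<^sub>3], rule exI[of _ N\<^sub>3], intro conjI both(1,3) outcome[OF both(2) close])
  qed
qed

end
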